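(* Let $\mathrm{v}=1$, $0<a<1$, and let $x\in X$ be a configuration whose density $\rho(x)$ is well defined, with $\rho(x)>\gamma_1:=(1+\lceil1/a\rceil)^{-1}$ and $\bar V(x)=1$ (i.e. $x$ belongs to the upper branch of the fundamental diagram). Then there exists an ultimately jammed configuration $y\in X$ which differs from $x$ on a set $S$ of sites having zero density.
   Context: Model. Fix an acceleration $a>0$ and maximal velocity $\mathrm{v}$ (here $\mathrm{v}=1$). A configuration is $x=\{x_i\}_{i\in\mathbb Z}$; $x_i\ge 0$ means that there is a particle at site $i$ with velocity $x_i$, and $x_i=-1$ means that site $i$ is a hole. For a configuration and $i\in\mathbb Z$, $i_-\le i$ is the site of the closest particle at or to the left of $i$, and $i_+>i$ is the site of the closest particle strictly to the right of $i$ ($i_+=+\infty$ if there is none). The configuration is admissible if $x_i\in[0,\mathrm{v}]\cup\{-1\}$ and $i_-+x_{i_-}<i_+$ for all $i$ (whenever $i_-$ exists); $X$ is the set of admissible configurations, always assumed to contain at least one particle. The dynamics is $T=\mathcal A\circ\sigma:X\to X$ with $(\sigma x)_i=x_{i_-}$ if $i_-+\lfloor x_{i_-}\rfloor=i$ and $(\sigma x)_i=-1$ otherwise; $(\mathcal A x)_i=\min\{x_i+a,\ i_+-i-1,\ \mathrm{v}\}$ if $x_i\ge0$ and $(\mathcal A x)_i=-1$ otherwise ($i_+$ computed in the configuration to which $\mathcal A$ is applied). Densities. $\rho(x[n,m])$ is the number of particles at sites $n,\dots,m$ divided by $m-n+1$; $\rho(x)=\lim_{n\to\infty}\rho(x[1,n])$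 when the limit exists. As for particles, densities see only the right tail: a set $S\subset\mathbb Z$ has zero density if $|S\cap[1,n]|/n\to0$ as $n\to\infty$. Velocity. $L(x,i,t)$ is the distance covered in $t$ time steps by the particle initially at $i_-$; $\bar V(x)=\lim_{t\to\infty}L(x,i,t)/t$ (when the limit exists it does not depend on $i$). Jams ($\mathrm{v}=1$). A segment $x[n,m]$, $n\le m$, is a jam if $0\le x_i<1$ for $n\le i\le m$, $x_{n-1}<0$ and $|x_{m+1}|\ge1$; the particle at $m$ is its leading particle. The particles in a jam change with time: leading particles become free (upon reaching velocity 1) and new particles join the jam from behind; a jam cannot split into several jams. $J(t)$ denotes the segment corresponding to the given jam $J=J(0)$ at time $t$, $|J(t)|$ its length, and the life-time of $J$ is $\tau(J):=\sup\{t>0:\ |J(t)|>0\}$. (If a particle that has not joined $J$ is stopped, at time $\tau(J)+1$, by the last particle of $J$, which has just got velocity 1 but has not started moving yet, then $J$ has already ceased to exist and the stopped particle creates a new jam.) The basin of attraction of $J=x[n,m]$ is the segment $x[k,m]$, $k\le n\le m$, containing all particles which will eventually at positive time join the jam or can be stopped by a particle from $J$ during the time $\tau(J)+1$; $k=-\infty$ is possible. Having an infinite basin of attraction and having an infinite life-time ($|J(t)|>0$ for all $t\ge0$) are treated as the same property. Ultimately jammed. Configurations $x,y\in X$ are equivalent if there is $k$ with $x_i=y_i$ for all $i\ge k$. A configuration $x\in X$ is ultimately jammed if some configuration equivalent to it has, for every $n\in\mathbb Z$, a jam with infinite basin of attraction located at time $0$ to the right of site $n$. As the motion of a particle does not depend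 on the particles to its left, for an ultimately jammed configuration one assumes that all sites with nonpositive numbers are occupied by particles with zero velocity. *)

theory Defs
  imports "HOL-Analysis.Analysis" "HOL-Library.Extended_Nat"
begin

(* The maximal velocity is v = 1 throughout.  A hole is the value -1. *)

type_synonym config = "int \<Rightarrow> real"

definition particle :: "config \<Rightarrow> int \<Rightarrow> bool" where
  "particle x i \<longleftrightarrow> 0 \<le> x i"

definition has_left :: "config \<Rightarrow> int \<Rightarrow> bool" where
  "has_left x i \<longleftrightarrow> (\<exists>j\<le>i. particle x j)"

(* i_-; meaningful only under has_left x i *)
definition left_site :: "config \<Rightarrow> int \<Rightarrow> int" where
  "left_site x i = (GREATEST j. j \<le> i \<and> particle x j)"

definition has_right :: "config \<Rightarrow> int \<Rightarrow> bool" where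
  "has_right x i \<longleftrightarrow> (\<exists>j>i. particle x j)"

(* i_+; the case i_+ = +\<infinity> is \<not> has_right x i *)
definition right_site :: "config \<Rightarrow> int \<Rightarrow> int" where
  "right_site x i = (LEAST j. i < j \<and> particle x j)"

definition admissible :: "config \<Rightarrow> bool" where
  "admissible x \<longleftrightarrow>
     (\<forall>i. x i \<in> {0..1} \<union> {-1}) \<and>
     (\<forall>i. has_left x i \<and> has_right x i \<longrightarrow>
        of_int (left_site x i) + x (left_site x i) < of_int (right_site x i))"

definition X :: "config set" where
  "X = {x. admissible x \<and> (\<exists>i. particle x i)}"

definition shift_map :: "config \<Rightarrow> config" where
  "shift_map x i =
     (if has_left x i \<and> left_site x i + \<lfloor>x (left_site x i)\<rfloor> = i
      then x (left_site x i) else -1)"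

definition accel_map :: "real \<Rightarrow> config \<Rightarrow> config" where
  "accel_map a x i =
     (if particle x i then
        (if has_right x i
         then min (min (x i + a) (of_int (right_site x i - i - 1))) 1
         else min (x i + a) 1)
      else -1)"

definition T :: "real \<Rightarrow> config \<Rightarrow> config" where
  "T a = accel_map a \<circ> shift_map"

definition has_density :: "config \<Rightarrow> real \<Rightarrow> bool" where
  "has_density x \<rho> \<longleftrightarrow>
     (\<lambda>n::nat. real (card {i \<in> {1..int n}. particle x i}) / real n) \<longlonglongrightarrow> \<rho>"

definition zero_density :: "int set \<Rightarrow> bool" where
  "zero_density S \<longleftrightarrow> (\<lambda>n::nat. real (card (S \<inter> {1..int n})) / real n) \<longlonglongrightarrow> 0"

(* Site, after t steps, of the particle initially at site j. *)
primrec pos :: "real \<Rightarrow> config \<Rightarrow> int \<Rightarrow> nat \<Rightarrow> int" where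
  "pos a x j 0 = j"
| "pos a x j (Suc t) = pos a x j t + \<lfloor>(T a ^^ t) x (pos a x j t)\<rfloor>"

definition L :: "real \<Rightarrow> config \<Rightarrow> int \<Rightarrow> nat \<Rightarrow> int" where
  "L a x i t = pos a x (left_site x i) t - left_site x i"

definition has_velocity :: "real \<Rightarrow> config \<Rightarrow> real \<Rightarrow> bool" where
  "has_velocity a x V \<longleftrightarrow>
     (\<forall>i. has_left x i \<longrightarrow> (\<lambda>t::nat. of_int (L a x i t) / real t) \<longlonglongrightarrow> V)"

definition jam :: "config \<Rightarrow> int \<Rightarrow> int \<Rightarrow> bool" where
  "jam x n m \<longleftrightarrow> n \<le> m \<and> (\<forall>i\<in>{n..m}. 0 \<le> x i \<and> x i < 1) \<and>
     x (n - 1) < 0 \<and> 1 \<le> \<bar>x (m + 1)\<bar>"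

(* Sites of J(t), for J = x[n,m].  A particle of a jam has velocity < 1 and so keeps its site
   during the next step.  Hence a jam at time t + 1 shares a site with J(t) iff it contains a
   particle of J(t), and there is at most one such jam.  A particle stopped by the last particle
   of J, which has just reached velocity 1, forms a jam disjoint from J(t): it does not
   continue J. *)
primrec jam_at :: "real \<Rightarrow> config \<Rightarrow> int \<Rightarrow> int \<Rightarrow> nat \<Rightarrow> int set" where
  "jam_at a x n m 0 = {n..m}"
| "jam_at a x n m (Suc t) =
     \<Union>{{p..q} | p q. jam ((T a ^^ Suc t) x) p q \<and> {p..q} \<inter> jam_at a x n m t \<noteq> {}}"

definition lifetime :: "real \<Rightarrow> config \<Rightarrow> int \<Rightarrow> int \<Rightarrow> enat" where
  "lifetime a x n m = (SUP t\<in>{t. 0 < t \<and> 0 < card (jam_at a x n m t)}. enat t)"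

definition joins :: "real \<Rightarrow> config \<Rightarrow> int \<Rightarrow> int \<Rightarrow> int \<Rightarrow> bool" where
  "joins a x n m j \<longleftrightarrow>
     (\<exists>t. pos a x j t \<notin> jam_at a x n m t \<and> pos a x j (Suc t) \<in> jam_at a x n m (Suc t))"

(* The particle j arrives at time t + 1 at the site directly behind a particle l that belonged
   to the jam at time t, and has velocity 0 there.  For t = lifetime this is the case of a
   particle stopped when the jam has already ceased to exist. *)
definition stopped_by :: "real \<Rightarrow> config \<Rightarrow> int \<Rightarrow> int \<Rightarrow> int \<Rightarrow> bool" where
  "stopped_by a x n m j \<longleftrightarrow>
     (\<exists>t l. enat (Suc t) \<le> lifetime a x n m + 1 \<and>
        particle x l \<and> pos a x l t \<in> jam_at a x n m t \<and>
        pos a x j (Suc t) \<noteq> pos a x j t \<and>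
        pos a x l (Suc t) = pos a x j (Suc t) + 1 \<and>
        (T a ^^ Suc t) x (pos a x j (Suc t)) = 0)"

(* The smallest segment [k,m] with k \<le> n that contains the initial sites of all these
   particles; k = -\<infinity> gives {..m}. *)
definition basin :: "real \<Rightarrow> config \<Rightarrow> int \<Rightarrow> int \<Rightarrow> int set" where
  "basin a x n m =
     {i. i \<le> m \<and>
        (n \<le> i \<or> (\<exists>j\<le>i. particle x j \<and> (joins a x n m j \<or> stopped_by a x n m j)))}"

definition infinite_basin :: "real \<Rightarrow> config \<Rightarrow> int \<Rightarrow> int \<Rightarrow> bool" where
  "infinite_basin a x n m \<longleftrightarrow> basin a x n m = {..m}"

definition equivalent :: "config \<Rightarrow> config \<Rightarrow> bool" where
  "equivalent x y \<longleftrightarrow> (\<exists>k. \<forall>i\<ge>k. x i = y i)"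

(* The equivalent configuration z in which the jams are observed carries the normalization that
   all nonpositive sites are occupied by particles with zero velocity; without particles
   arbitrarily far to the left no basin could be infinite. *)
definition ultimately_jammed :: "real \<Rightarrow> config \<Rightarrow> bool" where
  "ultimately_jammed a x \<longleftrightarrow> x \<in> X \<and>
     (\<exists>z\<in>X. equivalent x z \<and> (\<forall>i\<le>0. z i = 0) \<and>
        (\<forall>n. \<exists>p q. n < p \<and> jam z p q \<and> infinite_basin a z p q))"

definition gamma1 :: "real \<Rightarrow> real" where
  "gamma1 a = 1 / (1 + of_int \<lceil>1 / a\<rceil>)"

end

(* Let K = ceiling (1/a).  A stopped particle needs K steps to reach velocity 1, so a jam whose
   particles are at rest loses its leader every K steps, whatever happens in front of it.  With
   particles numbered 0, 1, 2, ... from the leader at site q to the left, the jam survives iff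
   particle s sits at site q - s when particle s - 1 departs.  This holds for every s as soon as
   each segment reaching from a particle behind the jam to q has slightly more than length/(K+1)
   particles, since being stopped on the way only aligns a particle with its predecessor, delayed
   by K.  As rho > 1/(K+1), this supply condition is enforced at very sparse sites q_k by replacing
   x with 0 on blocks of length o(q_k) that end in q_k, isolated by holes. *)
theory Submission
  imports Defs "HOL-Real_Asymp.Real_Asymp"
begin

section \<open>Local form of the dynamics\<close>

text \<open>Why the threshold is 1/(K + 1): a particle at rest at \<open>e s\<close> that nobody
  stops spends K steps accelerating and then \<open>q - int s - e s\<close> steps moving, and it
  must be at \<open>q - int s\<close> by time s * K - 1. Rearranged, this is (K + 1) * s >= q - e s
  + K + 1: one particle per K + 1 sites, up to a constant. Why short blocks suffice: l packed sites
  hold l particles where l/(K + 1) are required, a surplus of at least l/2. It has to pay for the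
  fluctuation of the density, at most d = eps * q for large q, for the particles of x lost to
  earlier blocks, kept below d/2, and for the constant. A length of about 4 * d does this, and it is
  o(q) if eps tends to 0. Earlier blocks can cost as many particles as there are sites up to their
  end, so each q is chosen after the previous one and much larger. Every nonpositive site is
  occupied, so extending a segment beyond 0 only improves its supply.\<close>

definition legal :: "config \<Rightarrow> bool" where
  "legal w \<longleftrightarrow> (\<forall>i. w i = -1 \<or> 0 \<le> w i \<and> w i \<le> 1) \<and> (\<forall>i. w i = 1 \<longrightarrow> w (i + 1) = -1)"

lemma legal_range: "legal w \<Longrightarrow> w i = -1 \<or> 0 \<le> w i \<and> w i \<le> 1"
  by (simp add: legal_def)

lemma legal_le_1: "legal w \<Longrightarrow> w i \<le> 1"
  using legal_range[of w i] by auto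

lemma legal_hole: "legal w \<Longrightarrow> w i = 1 \<Longrightarrow> w (i + 1) = -1"
  by (simp add: legal_def)

lemma legal_less_1: "legal w \<Longrightarrow> particle w (i + 1) \<Longrightarrow> w i < 1"
  using legal_range[of w i] legal_hole[of w i] by (force simp: particle_def)

lemma finite_int_window [simp]: "finite {j :: int. i \<le> j \<and> j \<le> m \<and> R j}"
  by (rule finite_subset[of _ "{i..m}"]) auto

lemma int_greatest_exists:
  fixes b j :: int
  assumes "P j" "\<And>i. P i \<Longrightarrow> i \<le> b"
  shows "\<exists>m. P m \<and> (\<forall>i. P i \<longrightarrow> i \<le> m)"
proof -
  let ?S = "{i \<in> {j..b}. P i}"
  have S: "finite ?S" "?S \<noteq> {}"
    using assms by auto
  have "P (Max ?S)" using Max_in[OF S] by simp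
  moreover have "i \<le> Max ?S" if "P i" for i
  proof (cases "j \<le> i")
    case True
    then show ?thesis using that assms(2) S by (intro Max_ge) auto
  next
    case False
    moreover have "j \<le> Max ?S" using assms S by (intro Max_ge) auto
    ultimately show ?thesis by simp
  qed
  ultimately show ?thesis by blast
qed

lemma left_site_props:
  assumes "has_left x i"
  shows "left_site x i \<le> i" "particle x (left_site x i)"
    and "\<And>j. j \<le> i \<Longrightarrow> particle x j \<Longrightarrow> j \<le> left_site x i"
proof -
  obtain j where "j \<le> i \<and> particle x j" using assms by (auto simp: has_left_def)
  then have "\<exists>m. (m \<le> i \<and> particle x m) \<and> (\<forall>k. k \<le> i \<and> particle x k \<longrightarrow> k \<le> m)"
    by (rule int_greatest_exists[where b = i]) simp
  then obtain m where m: "m \<le> i" "particle x m" "\<And>k. k \<le> i \<Longrightarrow> particle x k \<Longrightarrow> k \<le> m"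
    by blast
  then have "left_site x i = m"
    unfolding left_site_def by (intro Greatest_equality) auto
  then show "left_site x i \<le> i" "particle x (left_site x i)"
    and "\<And>j. j \<le> i \<Longrightarrow> particle x j \<Longrightarrow> j \<le> left_site x i"
    using m by auto
qed

lemma right_site_props:
  assumes "has_right x i"
  shows "i < right_site x i" "particle x (right_site x i)"
    and "\<And>j. i < j \<Longrightarrow> particle x j \<Longrightarrow> right_site x i \<le> j"
proof -
  obtain j where "i < j \<and> particle x j" using assms by (auto simp: has_right_def)
  then have "i < - (- j) \<and> particle x (- (- j))" by simp
  moreover have "k \<le> - i" if "i < - k \<and> particle x (- k)" for k using that by linarith
  ultimately have "\<exists>m. (i < - m \<and> particle x (- m)) \<and>
      (\<forall>k. i < - k \<and> particle x (- k) \<longrightarrow> k \<le> m)"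
    by (rule int_greatest_exists)
  then obtain m where m: "i < - m" "particle x (- m)"
      "\<And>k. i < - k \<Longrightarrow> particle x (- k) \<Longrightarrow> k \<le> m"
    by blast
  have "right_site x i = - m"
    unfolding right_site_def
  proof (intro Least_equality)
    fix y assume "i < y \<and> particle x y"
    then show "- m \<le> y" using m(3)[of "- y"] by simp
  qed (use m in auto)
  moreover have "- m \<le> j" if "i < j" "particle x j" for j
    using m(3)[of "- j"] that by simp
  ultimately show "i < right_site x i" "particle x (right_site x i)"
    and "\<And>j. i < j \<Longrightarrow> particle x j \<Longrightarrow> right_site x i \<le> j"
    using m by auto
qed

lemma left_site_particle: "particle x i \<Longrightarrow> left_site x i = i"
  unfolding left_site_def by (rule Greatest_equality) auto

text \<open>A velocity below 1 never reaches the next site, so for maximal velocity 1 the exclusion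
  condition only restricts particles of velocity 1, and only through the adjacent site.\<close>

lemma admissible_iff_legal: "admissible w \<longleftrightarrow> legal w"
proof
  assume adm: "admissible w"
  then have range: "w i = -1 \<or> 0 \<le> w i \<and> w i \<le> 1" for i
    by (auto simp: admissible_def)
  moreover have "w (i + 1) = -1" if "w i = 1" for i
  proof (rule ccontr)
    assume "w (i + 1) \<noteq> -1"
    then have p: "particle w (i + 1)" using range[of "i + 1"] by (auto simp: particle_def)
    have q: "particle w i" using that by (simp add: particle_def)
    have r: "has_right w i" "has_left w i"
      using p q by (auto simp: has_right_def has_left_def intro: exI[of _ "i + 1"])
    have "right_site w i \<le> i + 1"
      using right_site_props(3)[OF r(1)] p by simp
    moreover have "of_int i + w i < of_int (right_site w i)"
      using adm r left_site_particle[OF q] unfolding admissible_def by metis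
    ultimately show False using that by linarith
  qed
  ultimately show "legal w" by (simp add: legal_def)
next
  assume w: "legal w"
  have "of_int (left_site w i) + w (left_site w i) < of_int (right_site w i)"
    if "has_left w i" "has_right w i" for i
  proof -
    let ?l = "left_site w i" and ?r = "right_site w i"
    have lr: "?l < ?r" "particle w ?r"
      using left_site_props(1)[OF that(1)] right_site_props(1,2)[OF that(2)] by auto
    show ?thesis
    proof (cases "w ?l = 1")
      case True
      then have "?r \<noteq> ?l + 1"
        using legal_hole[OF w True] lr by (auto simp: particle_def)
      then have "?l + 2 \<le> ?r" using lr by simp
      then have "of_int ?l + 2 \<le> (of_int ?r :: real)" by linarith
      then show ?thesis using True by simp
    next
      case False
      then have "w ?l < 1" using legal_le_1[OF w, of ?l] by simp
      moreover have "of_int ?l + 1 \<le> (of_int ?r :: real)" using lr by linarith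
      ultimately show ?thesis by linarith
    qed
  qed
  moreover have "w i \<in> {0..1} \<union> {-1}" for i
    using legal_range[OF w, of i] by auto
  ultimately show "admissible w"
    unfolding admissible_def by blast
qed

lemma shift_map_legal:
  assumes w: "legal w"
  shows "shift_map w i =
    (if 0 \<le> w i \<and> w i < 1 then w i else if w (i - 1) = 1 then 1 else -1)"
proof -
  consider (slow) "0 \<le> w i" "w i < 1" | (fast) "w i = 1" | (hole) "w i = -1"
    using legal_range[OF w, of i] by fastforce
  then show ?thesis
  proof cases
    case slow
    then have "\<lfloor>w i\<rfloor> = 0" by (simp add: floor_eq_iff)
    moreover have "has_left w i" "left_site w i = i"
      using slow left_site_particle[of w i] by (auto simp: has_left_def particle_def)
    ultimately show ?thesis using slow by (simp add: shift_map_def)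
  next
    case fast
    then have "w (i - 1) \<noteq> 1" using legal_hole[OF w, of "i - 1"] by auto
    moreover have "left_site w i = i"
      using fast left_site_particle[of w i] by (auto simp: particle_def)
    ultimately show ?thesis using fast by (simp add: shift_map_def)
  next
    case hole
    show ?thesis
    proof (cases "w (i - 1) = 1")
      case True
      then have l: "has_left w i" by (auto simp: has_left_def particle_def intro!: exI[of _ "i - 1"])
      have "left_site w i = i - 1"
        using left_site_props[OF l] left_site_props(3)[OF l, of "i - 1"] hole True
        by (smt (verit) particle_def)
      then show ?thesis using l hole True by (simp add: shift_map_def)
    next
      case False
      have "left_site w i + \<lfloor>w (left_site w i)\<rfloor> \<noteq> i" if l: "has_left w i"
      proof
        let ?l = "left_site w i"
        assume eq: "?l + \<lfloor>w ?l\<rfloor> = i"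
        have "?l < i" using left_site_props(1,2)[OF l] hole by (smt (verit) particle_def)
        moreover have "\<lfloor>w ?l\<rfloor> \<le> 1" using legal_le_1[OF w, of ?l] by linarith
        ultimately have "\<lfloor>w ?l\<rfloor> = 1" "?l = i - 1" using eq by linarith+
        then have "w (i - 1) \<ge> 1" by (metis le_floor_iff of_int_1 order_refl)
        then show False using False legal_le_1[OF w, of "i - 1"] by simp
      qed
      then show ?thesis using False hole by (auto simp: shift_map_def)
    qed
  qed
qed

text \<open>The bound given by the distance to the next particle is an integer: it is 0 if the
  adjacent site is occupied, and otherwise at least 1, hence absorbed by the maximal
  velocity.\<close>

lemma accel_map_local:
  assumes "0 < a"
  shows "accel_map a u i =
    (if particle u i then if particle u (i + 1) then 0 else min (u i + a) 1 else -1)"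
proof (cases "particle u i \<and> has_right u i")
  case True
  note r = right_site_props[of u i]
  show ?thesis
  proof (cases "particle u (i + 1)")
    case p: True
    then have "right_site u i = i + 1" using True r(1) r(3)[of "i + 1"] by auto
    then show ?thesis using True p assms by (auto simp: accel_map_def particle_def)
  next
    case False
    then have "right_site u i \<noteq> i + 1" using r(2) True by auto
    then have "i + 2 \<le> right_site u i" using r(1) True by simp
    then have "(1 :: real) \<le> of_int (right_site u i - i - 1)" by linarith
    then show ?thesis using True False by (auto simp: accel_map_def min_def)
  qed
next
  case False
  then show ?thesis by (auto simp: accel_map_def has_right_def)
qed

text \<open>Only a slow particle at \<open>i + 1\<close> can block: the shift fills that site
  otherwise only from \<open>i\<close>, and then \<open>i\<close> itself is empty after the
  shift.\<close>

lemma T_local: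
  assumes "0 < a" and w: "legal w"
  shows "T a w i =
    (if 0 \<le> w i \<and> w i < 1 \<or> w (i - 1) = 1
     then if 0 \<le> w (i + 1) \<and> w (i + 1) < 1 then 0
          else if w (i - 1) = 1 then 1 else min (w i + a) 1
     else -1)"
proof -
  have hole: "w i = -1" if "w (i - 1) = 1" using legal_hole[OF w that] by simp
  have particle_shift: "particle (shift_map w) k \<longleftrightarrow> 0 \<le> w k \<and> w k < 1 \<or> w (k - 1) = 1" for k
    by (simp add: particle_def shift_map_legal[OF w, of k])
  have "T a w i =
    (if particle (shift_map w) i
     then if particle (shift_map w) (i + 1) then 0 else min (shift_map w i + a) 1 else -1)"
    by (simp only: T_def o_apply accel_map_local[OF assms(1)])
  also have "\<dots> = (if 0 \<le> w i \<and> w i < 1 \<or> w (i - 1) = 1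
     then if 0 \<le> w (i + 1) \<and> w (i + 1) < 1 then 0
          else if w (i - 1) = 1 then 1 else min (w i + a) 1
     else -1)"
  proof (cases "w (i - 1) = 1")
    case True
    then show ?thesis using hole assms(1)
      unfolding particle_shift shift_map_legal[OF w, of i] by simp
  next
    case False
    then show ?thesis
      unfolding particle_shift shift_map_legal[OF w, of i] by simp
  qed
  finally show ?thesis .
qed

lemma legal_T:
  assumes "0 < a" and w: "legal w"
  shows "legal (T a w)"
proof -
  note loc = T_local[OF assms]
  have "T a w i = -1 \<or> 0 \<le> T a w i \<and> T a w i \<le> 1" for i
  proof -
    have "0 \<le> min (w i + a) 1" if "0 \<le> w i" using that assms(1) by simp
    then show ?thesis unfolding loc[of i] min_def by (simp split: if_split)
  qed
  moreover have "T a w (i + 1) = -1" if T1: "T a w i = 1" for i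
  proof -
    have "\<not> (0 \<le> w (i + 1) \<and> w (i + 1) < 1)" "w i < 1 \<or> w (i - 1) = 1"
      using T1 unfolding loc[of i] by (simp_all split: if_splits)
    moreover have "w (i - 1) = 1 \<Longrightarrow> w i = -1" using legal_hole[OF w, of "i - 1"] by simp
    ultimately show ?thesis unfolding loc[of "i + 1"] by auto
  qed
  ultimately show ?thesis by (simp add: legal_def)
qed

lemma legal_funpow: "0 < a \<Longrightarrow> legal w \<Longrightarrow> legal ((T a ^^ t) w)"
  by (induction t) (simp_all add: legal_T)

lemma floor_velocity:
  assumes "legal w" "particle w i"
  shows "\<lfloor>w i\<rfloor> = (if w i = 1 then 1 else 0)"
  using legal_range[OF assms(1), of i] assms(2)
  by (auto simp: particle_def floor_eq_iff)

lemma particle_T_iff: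
  assumes "0 < a" "legal w"
  shows "particle (T a w) i \<longleftrightarrow> 0 \<le> w i \<and> w i < 1 \<or> w (i - 1) = 1"
  using assms by (auto simp: T_local[OF assms] particle_def)

text \<open>Seen from a moving particle, one step either stops it directly behind another one or
  accelerates it freely; velocity 1 is covered by the second case because of the cut-off.\<close>

lemma T_velocity:
  assumes a: "0 < a" and w: "legal w" and i: "particle w i"
  shows "T a w (i + \<lfloor>w i\<rfloor>) = 0 \<and> particle (T a w) (i + \<lfloor>w i\<rfloor> + 1)
    \<or> T a w (i + \<lfloor>w i\<rfloor>) = min (w i + a) 1"
proof (cases "w i = 1")
  case True
  then show ?thesis using a i legal_hole[OF w True]
    by (simp add: T_local[OF a w] particle_T_iff[OF a w] particle_def)
next
  case False
  then have "0 \<le> w i" "w i < 1" using i legal_le_1[OF w, of i] by (auto simp: particle_def)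
  moreover have "w (i - 1) \<noteq> 1" using legal_hole[OF w, of "i - 1"] i by (auto simp: particle_def)
  ultimately show ?thesis using False floor_velocity[OF w i]
    by (simp add: T_local[OF a w] particle_T_iff[OF a w])
qed

section \<open>Consecutive particles\<close>

text \<open>Indices grow to the left, so \<open>f 0\<close> is the rightmost particle considered.
  The sequence is infinite, which suits configurations that are packed on the left
  half-line.\<close>

definition chain :: "config \<Rightarrow> (nat \<Rightarrow> int) \<Rightarrow> bool" where
  "chain w f \<longleftrightarrow> (\<forall>s. particle w (f s) \<and> f (Suc s) < f s \<and>
     (\<forall>i. f (Suc s) < i \<and> i < f s \<longrightarrow> \<not> particle w i))"

lemma chainD:
  assumes "chain w f"
  shows "particle w (f s)" "f (Suc s) < f s"
    and "f (Suc s) < i \<Longrightarrow> i < f s \<Longrightarrow> \<not> particle w i"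
  using assms by (auto simp: chain_def)

lemma chain_le: "chain w f \<Longrightarrow> f (s + k) \<le> f s - int k"
proof (induction k)
  case (Suc k)
  then show ?case using chainD(2)[of w f "s + k"] by simp
qed simp

text \<open>Order is preserved because a particle moves only onto a site that was a hole, and
  nothing appears in between because every particle after the step comes from one before it.\<close>

lemma chain_T:
  assumes a: "0 < a" and w: "legal w" and f: "chain w f"
  shows "chain (T a w) (\<lambda>s. f s + \<lfloor>w (f s)\<rfloor>)"
  unfolding chain_def
proof (intro allI conjI impI)
  fix s
  note fl = floor_velocity[OF w chainD(1)[OF f]]
  note rng = legal_range[OF w, of "f s"] chainD(1)[OF f, of s, unfolded particle_def]
  show "particle (T a w) (f s + \<lfloor>w (f s)\<rfloor>)"
    unfolding particle_T_iff[OF a w] fl using rng by auto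
  show "f (Suc s) + \<lfloor>w (f (Suc s))\<rfloor> < f s + \<lfloor>w (f s)\<rfloor>"
    using chainD(1,2)[OF f, of s] legal_hole[OF w, of "f (Suc s)"] unfolding fl
    by (smt (verit) particle_def)
  fix i
  assume "f (Suc s) + \<lfloor>w (f (Suc s))\<rfloor> < i \<and> i < f s + \<lfloor>w (f s)\<rfloor>"
  then have i: "f (Suc s) + \<lfloor>w (f (Suc s))\<rfloor> < i" "i < f s + \<lfloor>w (f s)\<rfloor>" by auto
  show "\<not> particle (T a w) i"
    unfolding particle_T_iff[OF a w]
  proof (intro notI, elim disjE conjE)
    assume "0 \<le> w i" "w i < 1"
    then show False
      using chainD(3)[OF f, of s i] i fl[of s] fl[of "Suc s"]
      by (smt (verit) particle_def)
  next
    assume "w (i - 1) = 1"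
    then show False
      using chainD(3)[OF f, of s "i - 1"] i fl[of s] fl[of "Suc s"]
      by (smt (verit) particle_def)
  qed
qed

lemma chain_pos:
  assumes "0 < a" "legal w" "chain w e"
  shows "chain ((T a ^^ t) w) (\<lambda>s. pos a w (e s) t)"
  using assms by (induction t) (auto intro: chain_T legal_funpow)

section \<open>Jams with dense supply\<close>

text \<open>
  The factor of \<open>a\<close> is the slack of particle \<open>s\<close>: how much later than \<open>t\<close> it may
  start moving at full speed and still arrive at \<open>q - s\<close> by time \<open>s * K - 1\<close>. A particle that is
  stopped behind particle \<open>s - 1\<close> inherits the slack of the latter increased by \<open>K\<close>, which is the
  time needed for accelerating from \<open>0\<close> to \<open>1\<close>.
\<close>
lemma arrival_invariant:
  fixes a :: real and K :: nat and q :: int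
  assumes a: "0 < a" "1 \<le> real K * a" and z: "legal z" and e: "chain z e"
    and e0: "e 0 = q"
    and dense: "\<And>s. e s \<ge> q - int s \<or> (int K + 1) * int s \<ge> q - e s + int K + 1"
  shows "pos a z (e s) t \<ge> q - int s \<or>
    (T a ^^ t) z (pos a z (e s) t)
      + a * of_int (pos a z (e s) t - 1 - int t - q + int s * (int K + 1)) \<ge> 1"
    (is "?I s t")
proof (induction t arbitrary: s)
  case 0
  show ?case
  proof (cases "e s \<ge> q - int s")
    case False
    \<comment> \<open>The supply condition says exactly that the slack is at least K at time 0.
      Since K * a >= 1, this is enough even for a particle at rest.\<close>
    then have "int K \<le> e s - 1 - q + int s * (int K + 1)"
      using dense[of s] by (simp add: algebra_simps)
    then have "real K \<le> of_int (e s - 1 - q + int s * (int K + 1))"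
      by (metis of_int_le_iff of_int_of_nat_eq)
    then have "a * real K \<le> a * of_int (e s - 1 - q + int s * (int K + 1))"
      using a(1) by (intro mult_left_mono) auto
    moreover have "0 \<le> z (e s)" using chainD(1)[OF e] by (simp add: particle_def)
    ultimately show ?thesis using a(2) by (simp add: mult.commute)
  qed simp
next
  case (Suc t)
  note inv_t = Suc.IH
  show ?case
  \<comment> \<open>A second induction, over the particles at the fixed time \<open>Suc t\<close>: a
    stopped particle takes its bound from its predecessor after the same step.\<close>
  proof (induction s)
    case 0
    have "chain ((T a ^^ t) z) (\<lambda>s. pos a z (e s) t)" for t
      by (rule chain_pos[OF a(1) z e])
    note ch = chainD(1)[OF this]
    have "e 0 \<le> pos a z (e 0) t" for t
    proof (induction t)
      case (Suc t)
      then show ?case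
        using floor_velocity[OF legal_funpow[OF a(1) z, of t] ch[of t 0]] by simp
    qed simp
    from this[of "Suc t"] have "q - int 0 \<le> pos a z (e 0) (Suc t)"
      unfolding e0 by linarith
    then show ?case by blast
  next
    case (Suc s)
    define w where "w = (T a ^^ t) z"
    define P where "P = pos a z (e (Suc s)) t"
    define P' where "P' = pos a z (e (Suc s)) (Suc t)"
    have w: "legal w" unfolding w_def by (rule legal_funpow[OF a(1) z])
    have w': "(T a ^^ Suc t) z = T a w" by (simp add: w_def)
    have P': "P' = P + \<lfloor>w P\<rfloor>" by (simp add: P'_def P_def w_def)
    have pP: "particle w P"
      unfolding w_def P_def by (rule chainD(1)[OF chain_pos[OF a(1) z e]])
    note ch' = chain_pos[OF a(1) z e, of "Suc t", unfolded w']
    define sl where "sl = P - 1 - int t - q + int (Suc s) * (int K + 1)"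
    define sl' where "sl' = P' - 1 - int (Suc t) - q + int (Suc s) * (int K + 1)"
    have old: "P \<ge> q - int (Suc s) \<or> w P + a * of_int sl \<ge> 1"
      using inv_t[of "Suc s"] unfolding P_def w_def sl_def .
    have "P' \<ge> q - int (Suc s) \<or> T a w P' + a * of_int sl' \<ge> 1"
    proof (cases "P' \<ge> q - int (Suc s)")
      case far: False
      have fl: "\<lfloor>w P\<rfloor> = (if w P = 1 then 1 else 0)" by (rule floor_velocity[OF w pP])
      have "P \<le> P'" using P' fl by simp
      then have inv: "w P + a * of_int sl \<ge> 1" using old far by simp
      consider (blocked) "T a w P' = 0" "particle (T a w) (P' + 1)"
        | (free) "T a w P' = min (w P + a) 1"
        using T_velocity[OF a(1) w pP] P' by auto
      then show ?thesis
      proof cases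
        case blocked
        define R where "R = pos a z (e s) (Suc t)"
        have "P' < R" "\<And>i. P' < i \<Longrightarrow> i < R \<Longrightarrow> \<not> particle (T a w) i"
          using chainD(2,3)[OF ch', of s] by (auto simp: P'_def R_def)
        then have R: "R = P' + 1" using blocked(2) by (metis less_irrefl not_less_iff_gr_or_eq zle_add1_eq_le zless_add1_eq)
        have "R \<ge> q - int s \<or>
          T a w R + a * of_int (R - 1 - int (Suc t) - q + int s * (int K + 1)) \<ge> 1"
          using Suc.IH by (simp only: R_def w')
        \<comment> \<open>The predecessor has not arrived either, since it is one site ahead of
          \<open>P'\<close> and \<open>P' < q - int (Suc s)\<close>.\<close>
        then have "T a w R + a * of_int (R - 1 - int (Suc t) - q + int s * (int K + 1)) \<ge> 1"
          using far R by auto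
        moreover have "T a w R \<le> 1" by (rule legal_le_1[OF legal_T[OF a(1) w]])
        ultimately have "0 \<le> a * of_int (R - 1 - int (Suc t) - q + int s * (int K + 1))"
          by linarith
        then have "0 \<le> R - 1 - int (Suc t) - q + int s * (int K + 1)"
          using a(1) by (simp only: zero_le_mult_iff of_int_0_le_iff) linarith
        \<comment> \<open>One site further back and one index higher: the slack changes by -1 + (K +
          1) = K, which pays for restarting from velocity 0.\<close>
        then have "int K \<le> sl'" unfolding sl'_def R by (simp add: algebra_simps)
        then have "real K \<le> of_int sl'" by linarith
        then have "a * real K \<le> a * of_int sl'" using a(1) by (intro mult_left_mono) auto
        then show ?thesis using a(2) blocked(1) by (simp add: mult.commute)
      next
        case free
        show ?thesis
        proof (cases "w P = 1")
          case True
          then have "sl' = sl" using P' fl by (simp add: sl_def sl'_def)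
          then show ?thesis using free inv True a(1) by simp
        next
          case False
          then have sl': "sl' = sl - 1" using P' fl by (simp add: sl_def sl'_def)
          \<comment> \<open>The step costs one unit of slack and gains \<open>a\<close> in velocity,
            unless the velocity is cut off at 1. For that case a nonnegative remaining slack is
            needed: it holds because the slack was a positive integer.\<close>
          have "w P < 1" using False legal_le_1[OF w, of P] by simp
          then have "0 < a * of_int sl" using inv by linarith
          then have "0 < sl" using a(1) by (simp add: zero_less_mult_iff)
          then have "0 \<le> a * of_int sl'" using a(1) sl' by simp
          moreover have "a * of_int sl = a + a * of_int sl'" unfolding sl' by (simp add: algebra_simps)
          then have "w P + a + a * of_int sl' \<ge> 1" using inv by simp
          ultimately show ?thesis using free by (simp add: min_def)
        qed
      qed
    qed simp
    then show ?case by (simp only: P'_def sl'_def w')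
  qed
qed

text \<open>Velocities are at most 1, so the invariant forces a nonnegative slack, and at this time
  the slack is the position minus \<open>q - int s\<close>. The -1 matters: particle s - 1 attains
  velocity 1 at time s * K, and a particle arriving only then would be stopped but would start a new
  jam.\<close>

lemma arrival:
  fixes a :: real and K :: nat and q :: int
  assumes a: "0 < a" "1 \<le> real K * a" and z: "legal z" and e: "chain z e"
    and e0: "e 0 = q"
    and dense: "\<And>s. e s \<ge> q - int s \<or> (int K + 1) * int s \<ge> q - e s + int K + 1"
    and t: "int t = int s * int K - 1"
  shows "pos a z (e s) t \<ge> q - int s"
proof (rule ccontr)
  let ?P = "pos a z (e s) t"
  assume far: "\<not> ?P \<ge> q - int s"
  then have "(T a ^^ t) z ?P + a * of_int (?P - 1 - int t - q + int s * (int K + 1)) \<ge> 1"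
    using arrival_invariant[OF a z e e0 dense, of s t] by blast
  then have "0 \<le> a * of_int (?P - 1 - int t - q + int s * (int K + 1))"
    using legal_le_1[OF legal_funpow[OF a(1) z, of t], of ?P] by linarith
  then have "0 \<le> ?P - 1 - int t - q + int s * (int K + 1)"
    using a(1) by (simp only: zero_le_mult_iff of_int_0_le_iff) linarith
  then show False using far t by (simp add: algebra_simps)
qed

section \<open>Persistence of a packed jam with dense supply, and its infinite basin\<close>

lemma T_packed:
  assumes "0 < a" "legal w" "w i = 0" "w (i + 1) = 0"
  shows "T a w i = 0"
  using assms legal_hole[OF assms(2), of "i - 1"] by (simp add: T_local[OF assms(1,2)])

text \<open>A resting particle directly behind a resting particle stays at rest, so the packed
  half-line is eroded by at most one site per step.\<close>

lemma frozen_tail: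
  assumes a: "0 < a" and z: "legal z" and left: "\<And>i. i \<le> 0 \<Longrightarrow> z i = 0"
  shows "i \<le> - int t \<Longrightarrow> (T a ^^ t) z i = 0"
proof (induction t arbitrary: i)
  case (Suc t)
  then show ?case
    using T_packed[OF a legal_funpow[OF a z, of t], of i] by simp
qed (use left in simp)

lemma frozen_pos:
  assumes "0 < a" "legal z" "\<And>i. i \<le> 0 \<Longrightarrow> z i = 0"
  shows "j \<le> - int t \<Longrightarrow> pos a z j t = j"
  by (induction t) (use frozen_tail[OF assms] in auto)

lemma jamD:
  assumes "jam w c b"
  shows "c \<le> b" "i \<in> {c..b} \<Longrightarrow> 0 \<le> w i \<and> w i < 1" "w (c - 1) < 0" "1 \<le> \<bar>w (b + 1)\<bar>"
  using assms by (auto simp: jam_def)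

lemma jam_unique:
  assumes J: "jam w c b" "jam w c' b'" and i: "i \<in> {c..b}" "i \<in> {c'..b'}"
  shows "c' = c" "b' = b"
proof -
  have "\<not> c' < c"
    using i jamD(3)[OF J(1)] jamD(2)[OF J(2), of "c - 1"] by auto
  moreover have "\<not> c < c'"
    using i jamD(3)[OF J(2)] jamD(2)[OF J(1), of "c' - 1"] by auto
  ultimately show "c' = c" by simp
  have "\<not> b' < b"
    using i jamD(4)[OF J(2)] jamD(2)[OF J(1), of "b' + 1"] by auto
  moreover have "\<not> b < b'"
    using i jamD(4)[OF J(1)] jamD(2)[OF J(2), of "b + 1"] by auto
  ultimately show "b' = b" by simp
qed

text \<open>\<open>Ka\<close> and \<open>below_K\<close> make K the number of steps from velocity 0
  to velocity 1. The first alternative of \<open>dense\<close> is there for the particles of the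
  block, which are in place from the beginning.\<close>

locale fed_jam =
  fixes a :: real and K :: nat and z :: config and e :: "nat \<Rightarrow> int" and p q :: int
  assumes a_pos: "0 < a" and K_pos: "0 < K" and Ka: "1 \<le> real K * a"
    and below_K: "\<And>u. u < K \<Longrightarrow> real u * a < 1"
    and legal_z: "legal z" and left_z: "\<And>i. i \<le> 0 \<Longrightarrow> z i = 0"
    and p_le_q: "p \<le> q" and block: "\<And>i. i \<in> {p..q} \<Longrightarrow> z i = 0"
    and hole_p: "z (p - 1) = -1" and hole_q: "z (q + 1) = -1"
    and chain_e: "chain z e" and e_0: "e 0 = q"
    and dense: "\<And>s. e s \<ge> q - int s \<or> (int K + 1) * int s \<ge> q - e s + int K + 1"
begin

abbreviation "W t \<equiv> (T a ^^ t) z"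
abbreviation "P s t \<equiv> pos a z (e s) t"

lemma W_Suc: "W (Suc t) = T a (W t)"
  by simp

lemmas legal_W = legal_funpow[OF a_pos legal_z]
lemmas chain_W = chain_pos[OF a_pos legal_z chain_e]
lemmas T_W = T_local[OF a_pos legal_W]

lemma pos_slow:
  assumes "0 \<le> W t (P s t)" "W t (P s t) < 1"
  shows "P s (Suc t) = P s t"
proof -
  have "\<lfloor>W t (P s t)\<rfloor> = 0" using assms by (simp add: floor_eq_iff)
  then show ?thesis by simp
qed

text \<open>Each leader is in office for K steps and has accelerated for \<open>t mod K\<close> of
  them. It is never blocked: ahead of it is a hole or, at the change of leaders, its predecessor
  with velocity 1, about to leave. Only that change needs the supply, through
  \<open>arrival\<close>.\<close>

lemma front:
  fixes t :: nat
  defines "r \<equiv> t div K"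
  shows "P r t = q - int r \<and> W t (q - int r) = real (t mod K) * a \<and>
    (W t (q - int r + 1) = -1 \<or> t mod K = 0 \<and> W t (q - int r + 1) = 1)"
  unfolding r_def
proof (induction t)
  case 0
  then show ?case using e_0 hole_q block[of q] p_le_q by simp
next
  case (Suc t)
  define r u w where "r = t div K" and "u = t mod K" and "w = W t"
  have uK: "u < K" using K_pos by (simp add: u_def)
  have w: "legal w" unfolding w_def by (rule legal_W)
  have P: "P r t = q - int r" and v: "w (q - int r) = real u * a"
    and ahead: "w (q - int r + 1) = -1 \<or> w (q - int r + 1) = 1"
    using Suc.IH by (auto simp: r_def u_def w_def)
  have v01: "0 \<le> w (q - int r)" "w (q - int r) < 1" using v below_K[OF uK] a_pos by auto
  have behind: "w (q - int r - 1) \<noteq> 1" using legal_hole[OF w, of "q - int r - 1"] v01 by auto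
  have v': "W (Suc t) (q - int r) = min (real (Suc u) * a) 1"
    unfolding W_Suc T_W using ahead v01 behind v by (auto simp: w_def algebra_simps)
  show ?case
  proof (cases "Suc u = K")
    case False
    then have u: "Suc u < K" using uK by simp
    have mods: "Suc t mod K = Suc u" "Suc t div K = r"
      using u by (auto simp: mod_Suc div_Suc u_def r_def)
    have "W (Suc t) (q - int r + 1) = -1"
      unfolding W_Suc T_W using ahead v01 by (auto simp: w_def)
    moreover have "P r (Suc t) = q - int r"
      using pos_slow[of t r] P v01 by (simp add: w_def)
    ultimately show ?thesis
      unfolding mods using v' below_K[OF u] by simp
  next
    case True
    then have mods: "Suc t mod K = 0" "Suc t div K = Suc r"
      by (auto simp: mod_Suc div_Suc u_def r_def)
    have "t = r * K + u" by (simp add: r_def u_def)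
    then have "int t = int (Suc r) * int K - 1" using True by (simp add: algebra_simps)
    then have "P (Suc r) t \<ge> q - int (Suc r)"
      by (rule arrival[OF a_pos Ka legal_z chain_e e_0 dense])
    moreover have "P (Suc r) t < P r t" by (rule chainD(2)[OF chain_W])
    ultimately have P': "P (Suc r) t = q - int r - 1" using P by simp
    then have pP: "particle w (q - int r - 1)"
      using chainD(1)[OF chain_W[of t], of "Suc r"] by (simp add: w_def)
    have s01: "0 \<le> w (q - int r - 1)" "w (q - int r - 1) < 1"
      using pP behind legal_le_1[OF w, of "q - int r - 1"] by (auto simp: particle_def)
    have "P (Suc r) (Suc t) = q - int (Suc r)"
      using pos_slow[of t "Suc r"] P' s01 by (simp add: w_def)
    moreover have "W (Suc t) (q - int (Suc r)) = 0"
      unfolding W_Suc T_W using s01 v01 by (simp add: w_def algebra_simps)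
    moreover have "W (Suc t) (q - int (Suc r) + 1) = 1"
      using v' True Ka by simp
    ultimately show ?thesis unfolding mods by simp
  qed
qed

lemma front_velocity:
  "0 \<le> W t (q - int (t div K))" "W t (q - int (t div K)) < 1"
  using front[of t] below_K[of "t mod K"] K_pos a_pos by auto

lemma front_ahead: "\<not> (0 \<le> W t (q - int (t div K) + 1) \<and> W t (q - int (t div K) + 1) < 1)"
  "1 \<le> \<bar>W t (q - int (t div K) + 1)\<bar>"
  using front[of t] by auto

text \<open>The block accounts for the numbers 0 to q - p. The hole at \<open>p - 1\<close> costs
  one site, and every later particle inherits this deficit.\<close>

lemma behind_block:
  assumes "q - p + 1 \<le> int s"
  shows "e s < q - int s"
proof -
  define s0 where "s0 = nat (q - p + 1)"
  have s0: "int s0 = q - p + 1" "s = s0 + (s - s0)" using p_le_q assms by (auto simp: s0_def)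
  have "e s0 \<le> p - 1" using chain_le[OF chain_e, of 0 s0] e_0 s0 by simp
  moreover have "e s0 \<noteq> p - 1"
    using chainD(1)[OF chain_e, of s0] hole_p by (auto simp: particle_def)
  ultimately have "e s0 < q - int s0" using s0 by simp
  then show ?thesis using chain_le[OF chain_e, of s0 "s - s0"] s0 by simp
qed

text \<open>The jam needs a left end. Without a hole behind the leader, particle s would sit at
  \<open>q - int s\<close> for all s from the leader on; but particles far to the left have not
  moved by time t, and they started strictly behind these sites.\<close>

lemma hole_behind_front: "\<exists>i \<le> q - int (t div K). \<not> particle (W t) i"
proof (rule ccontr)
  define r where "r = t div K"
  assume "\<not> ?thesis"
  then have all: "particle (W t) i" if "i \<le> q - int r" for i using that by (auto simp: r_def)
  have packed: "P (r + k) t = q - int r - int k" for k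
  proof (induction k)
    case 0
    then show ?case using front[of t] by (simp add: r_def)
  next
    case (Suc k)
    have "\<not> P (Suc (r + k)) t < P (r + k) t - 1"
      using chainD(3)[OF chain_W[of t], of "r + k" "P (r + k) t - 1"] all[of "P (r + k) t - 1"] Suc
      by auto
    then show ?case using chainD(2)[OF chain_W[of t], of "r + k"] Suc by simp
  qed
  \<comment> \<open>Large enough to be a number beyond the leader, to lie behind the block, and to
    give \<open>e s \<le> - int t\<close>, where nothing has moved yet.\<close>
  define s where "s = r + nat (q - p + 1) + nat q + t"
  have "int s = int r + (q - p + 1) + int (nat q) + int t" "q \<le> int (nat q)"
    using p_le_q by (auto simp: s_def)
  then have "e s \<le> - int t" using chain_le[OF chain_e, of 0 s] e_0 p_le_q by simp
  then have "P s t = e s" using frozen_pos[OF a_pos legal_z] left_z by blast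
  moreover have "e s < q - int s" by (rule behind_block) (simp add: s_def)
  moreover have "P s t = q - int s"
    using packed[of "nat (q - p + 1) + nat q + t"] by (simp add: s_def algebra_simps)
  ultimately show False by simp
qed

lemma jam_front: "\<exists>c. jam (W t) c (q - int (t div K))"
proof -
  define b where "b = q - int (t div K)"
  obtain i where i: "i \<le> b \<and> \<not> particle (W t) i" using hole_behind_front by (auto simp: b_def)
  then have "\<exists>m. (m \<le> b \<and> \<not> particle (W t) m) \<and> (\<forall>i. i \<le> b \<and> \<not> particle (W t) i \<longrightarrow> i \<le> m)"
    by (rule int_greatest_exists[where b = b]) simp
  then obtain m where m: "m \<le> b" "\<not> particle (W t) m"
    "\<And>i. i \<le> b \<Longrightarrow> \<not> particle (W t) i \<Longrightarrow> i \<le> m" by blast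
  have fv: "0 \<le> W t b" "W t b < 1" "1 \<le> \<bar>W t (b + 1)\<bar>"
    using front_velocity front_ahead by (auto simp: b_def)
  have "m \<noteq> b" using m(2) fv by (auto simp: particle_def)
  moreover have "0 \<le> W t i \<and> W t i < 1" if i: "i \<in> {m + 1..b}" for i
  proof (cases "i = b")
    case False
    then have "particle (W t) i" "particle (W t) (i + 1)"
      using i m(3)[of i] m(3)[of "i + 1"] by auto
    then show ?thesis using legal_less_1[OF legal_W] by (auto simp: particle_def)
  qed (use fv in auto)
  moreover have "W t m < 0" using m(2) by (simp add: particle_def)
  ultimately have "jam (W t) (m + 1) b" using m(1) fv(3) unfolding jam_def by auto
  then show ?thesis unfolding b_def by blast
qed

lemma jam_initial: "jam z p q"
  using p_le_q block hole_p hole_q by (simp add: jam_def)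

text \<open>The point is that the jam ending at the new leader continues the old one, i.e. shares a
  site with it. All old members except the leader are stopped, so the new jam reaches back to
  \<open>c\<close>; a common site could fail to exist only if the old jam consisted of a leader
  about to leave it.\<close>

lemma jam_at_eq:
  "\<exists>c. jam (W t) c (q - int (t div K)) \<and> jam_at a z p q t = {c..q - int (t div K)}"
proof (induction t)
  case 0
  then show ?case using jam_initial by auto
next
  case (Suc t)
  define b b' where "b = q - int (t div K)" and "b' = q - int (Suc t div K)"
  obtain c where c: "jam (W t) c b" "jam_at a z p q t = {c..b}"
    using Suc.IH unfolding b_def by blast
  obtain c' where c': "jam (W (Suc t)) c' b'" using jam_front unfolding b'_def by blast
  have b': "b' = b \<or> b' = b - 1" by (auto simp: b_def b'_def div_Suc)
  have stopped: "W (Suc t) i = 0" if "i \<in> {c..b - 1}" for i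
    unfolding W_Suc T_W using jamD(2)[OF c(1), of i] jamD(2)[OF c(1), of "i + 1"] that by simp
  have "c \<le> b'"
  proof (rule ccontr)
    assume "\<not> c \<le> b'"
    \<comment> \<open>The jam would be reduced to its leader in the last step before the change. But
      then the next particle has already arrived at \<open>c - 1\<close>, which is a hole.\<close>
    then have eq: "b' = b - 1" "c = b" using b' jamD(1)[OF c(1)] by auto
    define s where "s = Suc (t div K)"
    have r: "Suc t div K = s" "Suc t mod K = 0"
      using eq(1) by (auto simp: b_def b'_def div_Suc s_def split: if_splits)
    then have "Suc t = s * K" by (metis add.right_neutral div_mult_mod_eq)
    then have "int t + 1 = int s * int K" by (metis of_nat_Suc of_nat_mult add.commute)
    then have "P s t \<ge> q - int s"
      by (intro arrival[OF a_pos Ka legal_z chain_e e_0 dense]) simp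
    moreover have "P s t < b"
      using chainD(2)[OF chain_W[of t], of "t div K"] front[of t] by (simp add: s_def b_def)
    ultimately have "P s t = c - 1" using eq by (simp add: b_def s_def)
    then show False
      using chainD(1)[OF chain_W[of t], of s] jamD(3)[OF c(1)] by (simp add: particle_def)
  qed
  have "c' \<le> c"
  proof (rule ccontr)
    assume "\<not> c' \<le> c"
    then have i: "c' - 1 \<in> {c..b' - 1}" using jamD(1)[OF c'] by simp
    then have "W (Suc t) (c' - 1) = 0" using b' by (intro stopped) auto
    then show False using jamD(3)[OF c'] by simp
  qed
  have inter: "jam (W (Suc t)) x y \<and> {x..y} \<inter> {c..b} \<noteq> {} \<longleftrightarrow> x = c' \<and> y = b'" for x y
  proof
    assume "x = c' \<and> y = b'"
    then show "jam (W (Suc t)) x y \<and> {x..y} \<inter> {c..b} \<noteq> {}"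
      using c' \<open>c \<le> b'\<close> \<open>c' \<le> c\<close> jamD(1)[OF c(1)] by auto
  next
    assume "jam (W (Suc t)) x y \<and> {x..y} \<inter> {c..b} \<noteq> {}"
    then obtain i where J: "jam (W (Suc t)) x y" and i: "i \<in> {x..y}" "i \<in> {c..b}" by blast
    \<comment> \<open>The old jam may extend to \<open>b' + 1\<close>, but after the change this is
      the site of the old leader, which has velocity 1.\<close>
    have "i \<noteq> b' + 1"
      using jamD(2)[OF J i(1)] front_ahead(1)[of "Suc t"] unfolding b'_def by auto
    then have "i \<in> {c'..b'}" using i(2) b' \<open>c' \<le> c\<close> by auto
    then show "x = c' \<and> y = b'" using jam_unique[OF c' J _ i(1)] by auto
  qed
  have "jam_at a z p q (Suc t) = {c'..b'}"
    by (simp only: jam_at.simps c(2) inter) auto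
  then show ?case using c' unfolding b'_def by blast
qed

text \<open>Particle s is behind the segment at time 0 and leads the jam at time s * K, so it enters
  at some step in between.\<close>

lemma particle_joins:
  assumes "q - p + 1 \<le> int s"
  shows "joins a z p q (e s)"
proof -
  define A where "A t \<longleftrightarrow> P s t \<in> jam_at a z p q t" for t
  have "e s < p" using behind_block[OF assms] assms by simp
  then have "\<not> A 0" by (simp add: A_def)
  moreover have "A (s * K)"
  proof -
    obtain c where c: "jam (W (s * K)) c (q - int s)" "jam_at a z p q (s * K) = {c..q - int s}"
      using jam_at_eq[of "s * K"] K_pos by auto
    then show ?thesis using jamD(1)[OF c(1)] front[of "s * K"] K_pos by (simp add: A_def)
  qed
  moreover have "\<exists>t. \<not> A t \<and> A (Suc t)" if "\<not> A 0" "A n" for n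
    using that by (induction n) auto
  ultimately have "\<exists>t. \<not> A t \<and> A (Suc t)" by blast
  then show ?thesis by (simp add: joins_def A_def)
qed

lemma infinite_basin: "infinite_basin a z p q"
proof -
  have "\<exists>j\<le>i. particle z j \<and> joins a z p q j" if "i < p" "i \<le> q" for i
  proof -
    define s where "s = nat (q - i) + nat (q - p + 1)"
    have "e s \<le> i" using chain_le[OF chain_e, of 0 s] e_0 that p_le_q by (simp add: s_def)
    moreover have "joins a z p q (e s)" by (rule particle_joins) (simp add: s_def)
    ultimately show ?thesis using chainD(1)[OF chain_e, of s] by blast
  qed
  then show ?thesis unfolding infinite_basin_def basin_def by force
qed

end

text \<open>Counting is turned into numbering: iterating \<open>left_site\<close> from q yields the
  chain, and exactly s particles lie in \<open>{e s + 1..q}\<close>.\<close>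

lemma packed_jam_infinite_basin:
  fixes a :: real and z :: config and p q :: int
  defines "K \<equiv> \<lceil>1 / a\<rceil>"
  assumes a: "0 < a" and z: "legal z" and left: "\<And>i. i \<le> 0 \<Longrightarrow> z i = 0"
    and pq: "p \<le> q" and block: "\<And>i. i \<in> {p..q} \<Longrightarrow> z i = 0"
    and holes: "z (p - 1) = -1" "z (q + 1) = -1"
    and dense: "\<And>i. i < p \<Longrightarrow> particle z i \<Longrightarrow>
      (K + 1) * int (card {j \<in> {i + 1..q}. particle z j}) \<ge> q - i + K + 1"
  shows "jam z p q" "infinite_basin a z p q"
proof -
  define e where "e = rec_nat q (\<lambda>_ m. left_site z (m - 1))"
  have e_0: "e 0 = q" and e_Suc: "e (Suc s) = left_site z (e s - 1)" for s
    by (simp_all add: e_def)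
  have "particle z j" if "j \<le> 0" for j using left[OF that] by (simp add: particle_def)
  then have hl: "has_left z i" for i
    unfolding has_left_def by (intro exI[of _ "min i 0"]) auto
  have e_step: "e (Suc s) < e s" "particle z (e (Suc s))"
    "e (Suc s) < i \<Longrightarrow> i < e s \<Longrightarrow> \<not> particle z i" for s i
    using left_site_props(1,2)[OF hl, of "e s - 1"] left_site_props(3)[OF hl, of i "e s - 1"]
    unfolding e_Suc by auto
  have "particle z (e s)" for s
    using e_step(2) block[of q] pq e_0 by (cases s) (auto simp: particle_def)
  then have chain: "chain z e" using e_step by (auto simp: chain_def)
  have e_le: "e s \<le> q - int s" for s using chain_le[OF chain, of 0 s] e_0 by simp
  have count: "card {j \<in> {e s + 1..q}. particle z j} = s" for s
  proof (induction s)
    case (Suc s)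
    have "{j \<in> {e (Suc s) + 1..q}. particle z j} = insert (e s) {j \<in> {e s + 1..q}. particle z j}"
    proof (intro equalityI subsetI)
      fix j assume "j \<in> {j \<in> {e (Suc s) + 1..q}. particle z j}"
      then show "j \<in> insert (e s) {j \<in> {e s + 1..q}. particle z j}"
        using chainD(3)[OF chain, of s j] by (cases j "e s" rule: linorder_cases) auto
    qed (use chainD(1,2)[OF chain, of s] e_le[of s] in auto)
    then show ?case using Suc by simp
  qed (simp add: e_0)
  have K: "0 < K" using a by (simp add: K_def)
  have "1 / a \<le> of_int K" unfolding K_def by (rule le_of_int_ceiling)
  then have Ka: "1 \<le> real (nat K) * a" using a K by (simp add: field_simps)
  have below_K: "real u * a < 1" if "u < nat K" for u
  proof -
    have "int u < \<lceil>1 / a\<rceil>" using that K_def by simp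
    then have "real u < 1 / a" by (simp add: less_ceiling_iff)
    then show ?thesis using a by (simp add: field_simps)
  qed
  have supplied: "e s \<ge> q - int s \<or> (int (nat K) + 1) * int s \<ge> q - e s + int (nat K) + 1" for s
  proof (cases "p \<le> e s")
    case True
    have "{j \<in> {e s + 1..q}. particle z j} = {e s + 1..q}"
      using True block by (auto simp: particle_def)
    then have "card {e s + 1..q} = s" using count[of s] by metis
    then have "q - int s \<le> e s" by simp
    then show ?thesis ..
  next
    case False
    then show ?thesis using dense[of "e s"] chainD(1)[OF chain, of s] count[of s] K by simp
  qed
  interpret fed_jam a "nat K" z e p q
    by unfold_locales (use a K Ka below_K z left pq block holes chain e_0 supplied in auto)
  show "jam z p q" "infinite_basin a z p q" by (rule jam_initial, rule infinite_basin)
qed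

section \<open>Inserting sparse packed blocks\<close>

lemma eventually_real_ge: "\<forall>\<^sub>F n in sequentially. c \<le> real n"
  using filterlim_real_sequentially by (simp add: filterlim_at_top)

text \<open>A window is a difference of two prefixes. Long prefixes deviate from the density by a
  small multiple of their length, short ones by at most a constant, which a large n absorbs; hence
  one error term serves all windows within \<open>{1..int n}\<close>.\<close>

lemma density_window:
  fixes x :: config and \<rho> \<gamma> \<epsilon> :: real
  assumes dens: "has_density x \<rho>" and "\<gamma> \<le> \<rho>" and eps: "0 < \<epsilon>"
  shows "\<forall>\<^sub>F n in sequentially. \<forall>i m. 0 \<le> i \<longrightarrow> i \<le> m \<longrightarrow> m \<le> int n \<longrightarrow>
    real (card {j \<in> {i + 1..m}. particle x j}) \<ge> \<gamma> * of_int (m - i) - \<epsilon> * real n"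
proof -
  define N where "N m = real (card {j \<in> {1..m}. particle x j})" for m :: int
  have N_diff: "real (card {j \<in> {i + 1..m}. particle x j}) = N m - N i" if "0 \<le> i" "i \<le> m" for i m
  proof -
    have "{j \<in> {1..m}. particle x j} = {j \<in> {1..i}. particle x j} \<union> {j \<in> {i + 1..m}. particle x j}"
      using that by auto
    also have "card \<dots> = card {j \<in> {1..i}. particle x j} + card {j \<in> {i + 1..m}. particle x j}"
      by (intro card_Un_disjoint) auto
    finally show ?thesis by (simp add: N_def)
  qed
  have "\<forall>\<^sub>F k in sequentially. \<bar>N (int k) / real k - \<rho>\<bar> < \<epsilon> / 2"
    using tendstoD[OF dens[unfolded has_density_def], of "\<epsilon> / 2"] eps by (simp add: N_def dist_real_def)
  then obtain n0 where n0: "\<And>k. k \<ge> n0 \<Longrightarrow> \<bar>N (int k) / real k - \<rho>\<bar> < \<epsilon> / 2"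
    unfolding eventually_sequentially by blast
  have N_le: "N (int k) \<le> real k" for k
  proof -
    have "card {j \<in> {1..int k}. particle x j} \<le> card {1..int k}" by (rule card_mono) auto
    then show ?thesis by (simp add: N_def)
  qed
  have dev: "\<bar>N (int k) - \<rho> * real k\<bar> \<le> max (\<epsilon> / 2 * real k) ((1 + \<bar>\<rho>\<bar>) * real n0)" for k
  proof (cases "n0 \<le> k \<and> 0 < k")
    case True
    then have "N (int k) - \<rho> * real k = (N (int k) / real k - \<rho>) * real k"
      by (simp add: field_simps)
    then have "\<bar>N (int k) - \<rho> * real k\<bar> = \<bar>N (int k) / real k - \<rho>\<bar> * real k"
      by (simp add: abs_mult)
    also have "\<dots> \<le> \<epsilon> / 2 * real k"
      using n0[of k] True by (intro mult_right_mono) auto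
    finally show ?thesis by (rule max.coboundedI1)
  next
    case False
    then have k: "real k \<le> real n0" by auto
    have "0 \<le> N (int k)" by (simp add: N_def)
    then have "\<bar>N (int k) - \<rho> * real k\<bar> \<le> real k + \<bar>\<rho>\<bar> * real k"
      using N_le[of k] abs_triangle_ineq4[of "N (int k)" "\<rho> * real k"] by (simp add: abs_mult)
    also have "\<dots> \<le> real n0 + \<bar>\<rho>\<bar> * real n0" using k by (intro add_mono mult_left_mono) auto
    also have "\<dots> = (1 + \<bar>\<rho>\<bar>) * real n0" by (simp add: algebra_simps)
    finally show ?thesis by (rule max.coboundedI2)
  qed
  have "\<forall>\<^sub>F n in sequentially. real n \<ge> (1 + \<bar>\<rho>\<bar>) * real n0 / (\<epsilon> / 2)"
    by (rule eventually_real_ge)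
  then show ?thesis
  proof eventually_elim
    case (elim n)
    then have n: "(1 + \<bar>\<rho>\<bar>) * real n0 \<le> \<epsilon> / 2 * real n" using eps by (simp add: field_simps)
    have dev_n: "\<bar>N k - \<rho> * of_int k\<bar> \<le> \<epsilon> / 2 * real n" if k: "0 \<le> k" "k \<le> int n" for k
    proof -
      have "\<epsilon> / 2 * real (nat k) \<le> \<epsilon> / 2 * real n" using k eps by (intro mult_left_mono) auto
      then have "max (\<epsilon> / 2 * real (nat k)) ((1 + \<bar>\<rho>\<bar>) * real n0) \<le> \<epsilon> / 2 * real n"
        using n by (rule max.boundedI)
      with dev[of "nat k"] have "\<bar>N (int (nat k)) - \<rho> * real (nat k)\<bar> \<le> \<epsilon> / 2 * real n"
        by (rule order_trans)
      then show ?thesis using k by simp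
    qed
    show ?case
    proof (intro allI impI)
      fix i m :: int
      assume im: "0 \<le> i" "i \<le> m" "m \<le> int n"
      have "\<gamma> * of_int (m - i) \<le> \<rho> * of_int (m - i)" using assms(2) im by (intro mult_right_mono) auto
      also have "\<dots> = \<rho> * of_int m - \<rho> * of_int i" by (simp add: algebra_simps)
      also have "\<dots> \<le> N m - N i + \<epsilon> * real n"
      proof -
        have "\<bar>N m - \<rho> * of_int m\<bar> \<le> \<epsilon> / 2 * real n" "\<bar>N i - \<rho> * of_int i\<bar> \<le> \<epsilon> / 2 * real n"
          using im by (intro dev_n; simp)+
        moreover have "\<epsilon> / 2 * real n + \<epsilon> / 2 * real n = \<epsilon> * real n" by simp
        ultimately show ?thesis unfolding abs_le_iff by linarith
      qed
      finally show "real (card {j \<in> {i + 1..m}. particle x j}) \<ge> \<gamma> * of_int (m - i) - \<epsilon> * real n"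
        using N_diff[OF im(1,2)] by simp
    qed
  qed
qed

text \<open>The margins keep the hole \<open>p 0 - 1\<close> at a positive site and the holes of
  consecutive blocks at distinct sites.\<close>

locale zero_blocks =
  fixes x :: config and p q :: "nat \<Rightarrow> int"
  assumes legal_x: "legal x" and first: "1 < p 0"
    and p_le_q: "\<And>k. p k \<le> q k" and separated: "\<And>k. q k + 2 < p (Suc k)"
begin

definition packed :: "int set" where
  "packed = {..0} \<union> (\<Union>k. {p k..q k})"

definition gaps :: "int set" where
  "gaps = (\<Union>k. {p k - 1, q k + 1})"

definition y :: config where
  "y i = (if i \<in> packed then 0 else if i \<in> gaps then -1 else x i)"

lemma before: "j < k \<Longrightarrow> q j + 2 < p k"
proof (induction k)
  case (Suc k)
  then show ?case
    using separated[of k] p_le_q[of k] by (cases "j = k") auto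
qed simp

lemma p_gt: "int k + 1 < p k"
proof (induction k)
  case (Suc k)
  then show ?case using separated[of k] p_le_q[of k] by simp
qed (use first in simp)

lemma legal_y: "legal y"
  unfolding legal_def
proof (intro conjI allI impI)
  fix i
  show "y i = -1 \<or> 0 \<le> y i \<and> y i \<le> 1"
    using legal_range[OF legal_x, of i] by (simp add: y_def)
  assume y1: "y i = 1"
  then have i: "i \<notin> packed" "i \<notin> gaps" "x i = 1" by (auto simp: y_def split: if_splits)
  have "i + 1 \<notin> packed"
  proof
    assume "i + 1 \<in> packed"
    then consider "i + 1 \<le> 0" | k where "i + 1 \<in> {p k..q k}" by (auto simp: packed_def)
    then show False
    proof cases
      case 1
      then show False using i(1) by (simp add: packed_def)
    next
      case 2
      then have "i = p k - 1 \<or> i \<in> {p k..q k}" by auto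
      then show False using i(1,2) by (auto simp: packed_def gaps_def)
    qed
  qed
  then show "y (i + 1) = -1" using legal_hole[OF legal_x i(3)] by (simp add: y_def)
qed

lemma y_nonpos: "i \<le> 0 \<Longrightarrow> y i = 0"
  by (simp add: y_def packed_def)

lemma y_block: "i \<in> {p k..q k} \<Longrightarrow> y i = 0"
  by (auto simp: y_def packed_def)

lemma y_gap: "y (p k - 1) = -1" "y (q k + 1) = -1"
proof -
  have "i \<notin> packed" if i: "i = p k - 1 \<or> i = q k + 1" for i
  proof -
    have "0 < i" using i p_gt[of k] p_le_q[of k] by auto
    moreover have "i \<notin> {p j..q j}" for j
      using i before[of j k] before[of k j] p_le_q[of k] p_le_q[of j]
      by (cases j k rule: linorder_cases) auto
    ultimately show ?thesis by (auto simp: packed_def)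
  qed
  moreover have "p k - 1 \<in> gaps" "q k + 1 \<in> gaps" by (auto simp: gaps_def)
  ultimately show "y (p k - 1) = -1" "y (q k + 1) = -1" by (simp_all add: y_def)
qed

lemma differ_subset: "{i. x i \<noteq> y i} \<subseteq> {..0} \<union> (\<Union>k. {p k - 1..q k + 1})"
proof
  fix i assume "i \<in> {i. x i \<noteq> y i}"
  then have "i \<in> packed \<or> i \<in> gaps" by (auto simp: y_def split: if_splits)
  moreover have "{p k..q k} \<union> {p k - 1, q k + 1} \<subseteq> {p k - 1..q k + 1}" for k
    using p_le_q[of k] by auto
  ultimately show "i \<in> {..0} \<union> (\<Union>k. {p k - 1..q k + 1})"
    unfolding packed_def gaps_def by blast
qed

lemma y_between: "q k + 1 < i \<Longrightarrow> i < p (Suc k) - 1 \<Longrightarrow> y i = x i"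
proof (rule ccontr)
  assume i: "q k + 1 < i" "i < p (Suc k) - 1" and "y i \<noteq> x i"
  moreover have "i \<notin> {..0}" using i p_gt[of k] p_le_q[of k] by simp
  ultimately obtain j where j: "i \<in> {p j - 1..q j + 1}"
    using differ_subset[THEN subsetD, of i] by auto
  show False
  proof (cases "j \<le> k")
    case True
    then have "q j \<le> q k" using before[of j k] p_le_q[of k] by (cases "j = k") auto
    then show False using i j by simp
  next
    case False
    then have "p (Suc k) \<le> p j" using before[of "Suc k" j] p_le_q[of "Suc k"] by (cases "j = Suc k") auto
    then show False using i j by simp
  qed
qed

text \<open>If n lies between the starts of blocks k + 1 and k + 2, the changed sites in
  \<open>{1..int n}\<close> are at most everything up to \<open>q k + 1\<close> plus block k + 1
  with its two gaps. The ratio is then worst at the smallest such n,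
  \<open>p (Suc k) - 1\<close>.\<close>

lemma zero_density_differ:
  assumes eta: "\<eta> \<longlonglongrightarrow> 0"
    and small: "\<And>k. real_of_int (q k + 1 + (q (Suc k) - p (Suc k) + 3)) \<le> \<eta> k * of_int (p (Suc k) - 1)"
  shows "zero_density {i. x i \<noteq> y i}"
proof -
  define S where "S = {i. x i \<noteq> y i}"
  have bound: "\<exists>k\<ge>k0. real (card (S \<inter> {1..int n})) \<le> \<eta> k * real n"
    if n: "p (Suc k0) - 1 \<le> int n" for k0 n
  proof -
    have "\<exists>k\<ge>k0. p (Suc k) - 1 \<le> int n \<and> int n < p (Suc (Suc k)) - 1"
    proof -
      define k where "k = (LEAST k. int n < p (Suc k) - 1)"
      have k: "int n < p (Suc k) - 1"
        unfolding k_def by (rule LeastI[of _ n]) (use p_gt[of "Suc n"] in simp)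
      have "k0 < k"
      proof (rule ccontr)
        assume "\<not> k0 < k"
        then have "p (Suc k) \<le> p (Suc k0)"
          using before[of "Suc k" "Suc k0"] p_le_q[of "Suc k"] by (cases "k = k0") auto
        then show False using n k by simp
      qed
      then obtain l where l: "k = Suc l" "k0 \<le> l" by (cases k) auto
      have "\<not> int n < p (Suc l) - 1"
        using not_less_Least[of l "\<lambda>k. int n < p (Suc k) - 1"] l by (simp add: k_def)
      then show ?thesis using l k by auto
    qed
    then obtain k where k: "k0 \<le> k" "p (Suc k) - 1 \<le> int n" "int n < p (Suc (Suc k)) - 1" by blast
    have "S \<inter> {1..int n} \<subseteq> {1..q k + 1} \<union> {p (Suc k) - 1..q (Suc k) + 1}"
    proof
      fix i assume i: "i \<in> S \<inter> {1..int n}"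
      then obtain j where j: "i \<in> {p j - 1..q j + 1}" using differ_subset by (fastforce simp: S_def)
      have "j \<le> Suc k"
      proof (rule ccontr)
        assume "\<not> j \<le> Suc k"
        then have "p (Suc (Suc k)) \<le> p j"
          using before[of "Suc (Suc k)" j] p_le_q[of "Suc (Suc k)"] by (cases "j = Suc (Suc k)") auto
        then show False using i j k by simp
      qed
      moreover have "q j \<le> q k" if "j \<le> k"
        using that before[of j k] p_le_q[of k] by (cases "j = k") auto
      ultimately show "i \<in> {1..q k + 1} \<union> {p (Suc k) - 1..q (Suc k) + 1}"
        using i j by (cases "j = Suc k") auto
    qed
    then have "card (S \<inter> {1..int n}) \<le> card ({1..q k + 1} \<union> {p (Suc k) - 1..q (Suc k) + 1})"
      by (rule card_mono[rotated]) simp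
    also have "\<dots> \<le> card {1..q k + 1} + card {p (Suc k) - 1..q (Suc k) + 1}" by (rule card_Un_le)
    finally have card_le: "int (card (S \<inter> {1..int n})) \<le> q k + 1 + (q (Suc k) - p (Suc k) + 3)"
      using p_gt[of k] p_le_q[of k] p_le_q[of "Suc k"] by simp
    then have *: "real (card (S \<inter> {1..int n})) \<le> \<eta> k * of_int (p (Suc k) - 1)"
      using small[of k] by linarith
    have "0 \<le> \<eta> k * of_int (p (Suc k) - 1)" using * by (rule order_trans[rotated]) simp
    then have "0 \<le> \<eta> k" using p_gt[of "Suc k"] by (simp add: zero_le_mult_iff)
    then have "\<eta> k * of_int (p (Suc k) - 1) \<le> \<eta> k * real n"
      using k(2) by (intro mult_left_mono) linarith+
    then show ?thesis using * k(1) by auto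
  qed
  have "(\<lambda>n. real (card (S \<inter> {1..int n})) / real n) \<longlonglongrightarrow> 0"
  proof (rule LIMSEQ_I)
    fix r :: real assume r: "0 < r"
    then obtain k0 where k0: "\<And>k. k \<ge> k0 \<Longrightarrow> norm (\<eta> k - 0) < r"
      using LIMSEQ_D[OF eta] by blast
    show "\<exists>n0. \<forall>n\<ge>n0. norm (real (card (S \<inter> {1..int n})) / real n - 0) < r"
    proof (intro exI allI impI)
      fix n assume n: "nat (p (Suc k0)) \<le> n"
      then have n': "p (Suc k0) - 1 \<le> int n" "0 < n" using p_gt[of "Suc k0"] by auto
      obtain k where k: "k0 \<le> k" "real (card (S \<inter> {1..int n})) \<le> \<eta> k * real n"
        using bound[OF n'(1)] by blast
      then have "real (card (S \<inter> {1..int n})) / real n \<le> \<eta> k" using n'(2) by (simp add: field_simps)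
      moreover have "\<eta> k < r" using k0[OF k(1)] by simp
      ultimately show "norm (real (card (S \<inter> {1..int n})) / real n - 0) < r" by simp
    qed
  qed
  then show ?thesis by (simp add: zero_density_def S_def)
qed

end

section \<open>Choice of the block positions and the resulting configuration\<close>

lemma sparse_choice:
  fixes A :: "nat \<Rightarrow> nat \<Rightarrow> bool" and R :: "nat \<Rightarrow> nat \<Rightarrow> nat"
  assumes "\<And>k. \<forall>\<^sub>F n in sequentially. A k n"
  shows "\<exists>Q. \<forall>k. A k (Q k) \<and> R k (Q k) \<le> Q (Suc k)"
proof -
  have "\<exists>n\<ge>m. A k n" for k m
    using assms[of k] unfolding eventually_sequentially by (meson nle_le)
  then show ?thesis
    by (intro dependent_nat_choice) blast+
qed

text \<open>Here l is the block length, d the density error and B the loss to earlier blocks; q - l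
  - 1 - i is the length of the window from i + 1 to the site before the left gap. After
  multiplication by K + 1 the margin is K * l - (K + 1) * (d + B), which is at least K * d >= d >= K
  + 2.\<close>

lemma block_supply_bound:
  fixes K l i q B :: real
  assumes "1 \<le> K" "4 * d \<le> l" "B \<le> d / 2" "K + 2 \<le> d"
    and "c \<ge> l + (1 / (K + 1) * (q - l - 1 - i) - d) - B"
  shows "(K + 1) * c \<ge> q - i + K + 1"
proof -
  have "(K + 1) * c \<ge> (K + 1) * (l + (1 / (K + 1) * (q - l - 1 - i) - d) - B)"
    using assms by (intro mult_left_mono) auto
  also have "(K + 1) * (l + (1 / (K + 1) * (q - l - 1 - i) - d) - B)
    = (K + 1) * (l - d - B) + (q - l - 1 - i)"
    using assms(1) by (simp add: field_simps)
  finally have 1: "(K + 1) * c \<ge> (K + 1) * (l - d - B) + (q - l - 1 - i)" .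
  have "K * l \<ge> K * (4 * d)" using assms by (intro mult_left_mono) auto
  moreover have "(K + 1) * (d + B) \<le> (K + 1) * (3 / 2 * d)"
    using assms by (intro mult_left_mono) auto
  moreover have "1 * d \<le> K * d" using assms by (intro mult_right_mono) auto
  moreover have "(K + 1) * (l - d - B) = K * l + l - (K + 1) * (d + B)"
    "(K + 1) * (3 / 2 * d) = 3 / 2 * (K * d) + 3 / 2 * d" "K * (4 * d) = 4 * (K * d)"
    by (simp_all add: algebra_simps)
  ultimately show ?thesis using 1 assms(4) by linarith
qed

theorem theorem4p1:
  fixes a \<rho> :: real and x :: config
  assumes "0 < a" and "a < 1"
    and "x \<in> X"
    and "has_density x \<rho>" and "gamma1 a < \<rho>"
    and "has_velocity a x 1"
  shows "\<exists>y\<in>X. ultimately_jammed a y \<and> zero_density {i. x i \<noteq> y i}"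
proof -
  define K where "K = \<lceil>1 / a\<rceil>"
  have K: "1 \<le> K" using \<open>0 < a\<close> by (simp add: K_def)
  have gamma: "gamma1 a = 1 / (of_int K + 1)" by (simp add: gamma1_def K_def add.commute)
  have legal_x: "legal x" using \<open>x \<in> X\<close> by (simp add: X_def admissible_iff_legal)
  \<comment> \<open>The 10 makes \<open>d k\<close> at most a tenth of \<open>q k\<close>, so a
    block of length about 4 * d stays in the right half of \<open>{1..q k}\<close>.\<close>
  define \<epsilon> where "\<epsilon> k = 1 / (real k + 10)" for k
  have eps: "0 < \<epsilon> k" "\<epsilon> k \<le> 1 / 10" for k by (simp_all add: \<epsilon>_def field_simps)
  define A where "A k n \<longleftrightarrow> of_int K + 10 \<le> \<epsilon> k * real n \<and>
    (\<forall>i m. 0 \<le> i \<longrightarrow> i \<le> m \<longrightarrow> m \<le> int n \<longrightarrow>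
      real (card {j \<in> {i + 1..m}. particle x j}) \<ge> gamma1 a * of_int (m - i) - \<epsilon> k * real n)" for k n
  \<comment> \<open>Chosen so that the next error term, \<open>Q (Suc k)\<close> divided by k + 11,
    is at least twice \<open>Q k + 2\<close>: all earlier changes cost at most half of it.\<close>
  define R where "R k n = 2 * (n + 2) * (k + 11)" for k n :: nat
  have "\<forall>\<^sub>F n in sequentially. A k n" for k
  proof -
    have "\<forall>\<^sub>F n in sequentially. real n \<ge> (of_int K + 10) / \<epsilon> k"
      by (rule eventually_real_ge)
    then have "\<forall>\<^sub>F n in sequentially. of_int K + 10 \<le> \<epsilon> k * real n"
      by eventually_elim (use eps in \<open>simp add: field_simps\<close>)
    then show ?thesis
      unfolding A_def using density_window[OF \<open>has_density x \<rho>\<close> less_imp_le[OF \<open>gamma1 a < \<rho>\<close>] eps(1)[of k]]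
      by (rule eventually_conj)
  qed
  then obtain Q where A: "\<And>k. A k (Q k)" and R: "\<And>k. R k (Q k) \<le> Q (Suc k)"
    using sparse_choice[of A R] by blast
  define d l q p where "d k = \<epsilon> k * real (Q k)" and "l k = \<lceil>4 * d k\<rceil>"
    and "q k = int (Q k)" and "p k = q k - l k + 1" for k
  have d: "of_int K + 10 \<le> d k" "d k \<le> of_int (q k) / 10" for k
    using A[of k] eps(2)[of k] mult_right_mono[OF eps(2)[of k], of "real (Q k)"]
    by (auto simp: A_def d_def q_def)
  have d10: "11 \<le> d k" for k using d(1)[of k] K by linarith
  have l: "4 * d k \<le> of_int (l k)" "of_int (l k) \<le> 4 * d k + 1" for k
    unfolding l_def by linarith+
  have prev: "of_int (q k + 2) \<le> d (Suc k) / 2" for k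
  proof -
    have "real (R k (Q k)) \<le> real (Q (Suc k))" using R[of k] by (simp only: of_nat_le_iff)
    then show ?thesis by (simp add: R_def d_def q_def \<epsilon>_def field_simps)
  qed
  have p_half: "of_int (p k - 1) \<ge> of_int (q k) / (2 :: real)" for k
    using d(2)[of k] d10[of k] l(2)[of k] by (simp add: p_def)
  interpret zero_blocks x p q
  proof
    show "legal x" by (rule legal_x)
    show "1 < p 0" using p_half[of 0] d(2)[of 0] d10[of 0] by linarith
    show "p k \<le> q k" for k using l(1)[of k] d10[of k] by (simp add: p_def)
    show "q k + 2 < p (Suc k)" for k
      using p_half[of "Suc k"] d(2)[of "Suc k"] d10[of "Suc k"] prev[of k] by linarith
  qed
  have zero: "zero_density {i. x i \<noteq> y i}"
  proof (rule zero_density_differ[where \<eta> = "\<lambda>k. 12 * \<epsilon> (Suc k)"])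
    show "(\<lambda>k. 12 * \<epsilon> (Suc k)) \<longlonglongrightarrow> 0"
      unfolding \<epsilon>_def by real_asymp
    fix k
    \<comment> \<open>The block contributes 4 * d, the sites up to \<open>q k + 1\<close> at most
      d/2, and the rest covers rounding and gaps. The factor 12 arises because \<open>p - 1\<close>
      is only known to be at least q/2.\<close>
    have "of_int (q k + 1 + (q (Suc k) - p (Suc k) + 3)) \<le> 6 * d (Suc k)"
      using prev[of k] l(2)[of "Suc k"] d10[of "Suc k"] by (simp add: p_def)
    also have "\<dots> = 12 * \<epsilon> (Suc k) * (of_int (q (Suc k)) / 2)" by (simp add: d_def q_def)
    also have "\<dots> \<le> 12 * \<epsilon> (Suc k) * of_int (p (Suc k) - 1)"
      using p_half[of "Suc k"] eps(1)[of "Suc k"] by (intro mult_left_mono) auto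
    finally show "real_of_int (q k + 1 + (q (Suc k) - p (Suc k) + 3))
      \<le> 12 * \<epsilon> (Suc k) * of_int (p (Suc k) - 1)" .
  qed
  have count: "(K + 1) * int (card {j \<in> {i + 1..q (Suc k)}. particle y j}) \<ge> q (Suc k) - i + K + 1"
    if i: "0 \<le> i" "i \<le> p (Suc k) - 2" for i k
  proof -
    define k' where "k' = Suc k"
    define C where "C = {j \<in> {i + 1..p k' - 2}. particle x j}"
    define D where "D = {j \<in> {i + 1..q k'}. particle y j}"
    have fin: "finite C" "finite D" by (simp_all add: C_def D_def)
    \<comment> \<open>Up to \<open>q k + 1\<close> all particles of x are written off; from there to
      the left gap of the new block, y agrees with x.\<close>
    have "{p k'..q k'} \<union> (C - {1..q k + 1}) \<subseteq> D"
      using i y_block[of _ k'] y_between[of k] p_le_q[of k']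
      by (auto simp: C_def D_def k'_def particle_def)
    then have "card ({p k'..q k'} \<union> (C - {1..q k + 1})) \<le> card D"
      by (intro card_mono fin)
    moreover have "card ({p k'..q k'} \<union> (C - {1..q k + 1})) = card {p k'..q k'} + card (C - {1..q k + 1})"
      by (intro card_Un_disjoint) (auto simp: C_def)
    moreover have "card C - card {1..q k + 1} \<le> card (C - {1..q k + 1})"
      by (rule diff_card_le_card_Diff) simp
    moreover have "int (card {p k'..q k'}) = l k'" "int (card {1..q k + 1}) = q k + 1"
      using p_le_q[of k'] by (simp_all add: p_def q_def)
    ultimately have "int (card D) \<ge> l k' + int (card C) - (q k + 1)" by linarith
    then have D: "real (card D) \<ge> of_int (l k') + real (card C) - of_int (q k + 1)" by linarith
    have "real (card C) \<ge> gamma1 a * of_int (p k' - 2 - i) - d k'"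
      using A[of k'] i p_le_q[of k'] unfolding A_def C_def d_def k'_def q_def by force
    also have "of_int (p k' - 2 - i) = of_int (q k') - of_int (l k') - 1 - (of_int i :: real)"
      by (simp add: p_def)
    finally have "real (card D) \<ge> of_int (l k')
        + (1 / (of_int K + 1) * (of_int (q k') - of_int (l k') - 1 - of_int i) - d k') - of_int (q k + 1)"
      using D unfolding gamma by linarith
    then have "(of_int K + 1) * real (card D) \<ge> of_int (q k') - of_int i + of_int K + 1"
      using K l(1)[of k'] prev[of k] d(1)[of k'] by (intro block_supply_bound[of _ "d k'"]) (auto simp: k'_def)
    then have "of_int ((K + 1) * int (card D)) \<ge> (of_int (q k' - i + K + 1) :: real)" by simp
    then show ?thesis unfolding of_int_le_iff D_def k'_def .
  qed
  have dense: "(K + 1) * int (card {j \<in> {i + 1..q (Suc k)}. particle y j}) \<ge> q (Suc k) - i + K + 1"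
    if i: "i < p (Suc k)" "particle y i" for i k
  proof (cases "0 \<le> i")
    case True
    have "i \<noteq> p (Suc k) - 1" using i(2) y_gap(1)[of "Suc k"] by (auto simp: particle_def)
    then show ?thesis using i True by (intro count) auto
  next
    case False
    \<comment> \<open>Each nonpositive site is occupied: it adds K + 1 to the left side and only 1
      to the required amount, so the case i = 0 suffices.\<close>
    have "{j \<in> {i + 1..q (Suc k)}. particle y j} = {i + 1..0} \<union> {j \<in> {0 + 1..q (Suc k)}. particle y j}"
      using False by (auto simp: particle_def y_nonpos q_def)
    also have "card \<dots> = card {i + 1..0} + card {j \<in> {0 + 1..q (Suc k)}. particle y j}"
      by (intro card_Un_disjoint) auto
    finally have c: "int (card {j \<in> {i + 1..q (Suc k)}. particle y j})
        = - i + int (card {j \<in> {0 + 1..q (Suc k)}. particle y j})"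
      using False by simp
    have "(K + 1) * int (card {j \<in> {0 + 1..q (Suc k)}. particle y j}) \<ge> q (Suc k) - 0 + K + 1"
      using p_gt[of "Suc k"] by (intro count) auto
    moreover have "(K + 1) * (- i) \<ge> 1 * (- i)" using False K by (intro mult_right_mono) auto
    ultimately show ?thesis unfolding c distrib_left by linarith
  qed
  have jams: "jam y (p (Suc k)) (q (Suc k))" "infinite_basin a y (p (Suc k)) (q (Suc k))" for k
  proof -
    have supplied: "(\<lceil>1 / a\<rceil> + 1) * int (card {j \<in> {i + 1..q (Suc k)}. particle y j})
        \<ge> q (Suc k) - i + \<lceil>1 / a\<rceil> + 1"
      if "i < p (Suc k)" "particle y i" for i
      using dense[OF that] unfolding K_def .
    show "jam y (p (Suc k)) (q (Suc k))"
      by (rule packed_jam_infinite_basin(1)[OF \<open>0 < a\<close> legal_y])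
        (erule y_nonpos | erule y_block | rule p_le_q y_gap | erule (1) supplied)+
    show "infinite_basin a y (p (Suc k)) (q (Suc k))"
      by (rule packed_jam_infinite_basin(2)[OF \<open>0 < a\<close> legal_y])
        (erule y_nonpos | erule y_block | rule p_le_q y_gap | erule (1) supplied)+
  qed
  have "\<exists>b c. n < b \<and> jam y b c \<and> infinite_basin a y b c" for n
  proof -
    have "n < p (Suc (nat n))" using p_gt[of "Suc (nat n)"] by linarith
    then show ?thesis using jams[of "nat n"] by blast
  qed
  moreover have "y \<in> X"
    using legal_y y_nonpos[of 0] by (auto simp: X_def admissible_iff_legal particle_def intro!: exI[of _ 0])
  \<comment> \<open>\<open>y\<close> is its own witness, since it is already packed on the
    nonpositive sites.\<close>
  moreover have "equivalent y y" by (simp add: equivalent_def)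
  ultimately have "ultimately_jammed a y"
    using y_nonpos unfolding ultimately_jammed_def by blast
  then show ?thesis using \<open>y \<in> X\<close> zero by blast
qed

end
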